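(* Let $d\ge2$, $t\ge2$, let $X=\{x_1,\ldots,x_N\}\subset\mathbb S^{d-1}$ be a spherical $t$-design, and let its Steiner-normalized Minkowski polytope $P=P_X$ satisfy $P^\circ=cUP$ for some $c>0$ and $U\in O(d)$. Put $h_i=h_P(x_i)$. Then $P$ has exactly $N$ vertices, and they can be labeled $y_1,\ldots,y_N$ so that $$y_j=\frac1{c h_j}U^Tx_j,\qquad \frac{y_j}{|y_j|}=U^Tx_j\qquad(1\le j\le N).$$ Consequently, the radial vertex directions of $P$ form a spherical $t$-design orthogonally congruent to the facet-normal design $X$. Furthermore, $$\langle Ux_i,x_j\rangle\le c h_i h_j\qquad(1\le i,j\le N),$$ and equality holds if and only if the vertex $y_j$ lies on the facet of $P$ with outer normal $x_i$. Finally, $U^2P=P$.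
   Context: $\sigma$ is the normalized (probability) surface measure on the unit sphere $\mathbb S^{d-1}\subset\mathbb R^d$, and $\omega_{d-1}$ is the total $(d-1)$-area of $\mathbb S^{d-1}$. A finite set $X=\{x_1,\ldots,x_N\}\subset\mathbb S^{d-1}$ of $N$ distinct points is a spherical $t$-design if $\frac1N\sum_i p(x_i)=\int p\,d\sigma$ for every polynomial $p$ of total degree at most $t$. For $t\ge2$, the Minkowski polytope $P_X\subset\mathbb R^d$ is the full-dimensional convex polytope, unique up to translation, whose surface area measure is $\frac{\omega_{d-1}}N\sum_i\delta_{x_i}$: it has exactly $N$ facets, with outer unit normals $x_1,\ldots,x_N$, each of $(d-1)$-area $\omega_{d-1}/N$. It is Steiner-normalized: the translate is chosen so that the Steiner point $d\int_{\mathbb S^{d-1}}h_{P_X}(u)u\,d\sigma(u)$ is $0$, which implies $0\in\operatorname{int}P_X$. Here $h_P(u)=\max_{y\in P}\langle u,y\rangle$ is the support function and $P^\circ=\{z:\langle z,y\rangle\le1\ \forall y\in P\}$ is the polar. *)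

theory Defs
  imports "HOL-Analysis.Analysis"
begin

text \<open>
  The \<open>k\<close>-dimensional Hausdorff outer measure, for \<open>k \<ge> 1\<close>, normalised so that it agrees with
  \<open>k\<close>-dimensional Lebesgue measure on \<open>k\<close>-dimensional flats. Boundedness of the covering sets is
  required because \<^const>\<open>diameter\<close> is unspecified on unbounded sets; finite covers are included
  because \<open>C i\<close> may be empty, and the empty set has weight \<open>0\<close> as \<open>k \<ge> 1\<close>.
\<close>

definition hausdorff_pre :: "nat \<Rightarrow> real \<Rightarrow> 'a::metric_space set \<Rightarrow> ennreal" where
  "hausdorff_pre k \<delta> S =
     (INF C\<in>{C :: nat \<Rightarrow> 'a set. S \<subseteq> (\<Union>i. C i) \<and> (\<forall>i. bounded (C i) \<and> diameter (C i) \<le> \<delta>)}.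
        \<Sum>i. ennreal (unit_ball_vol (real k) * (diameter (C i) / 2) ^ k))"

definition hausdorff_outer :: "nat \<Rightarrow> 'a::metric_space set \<Rightarrow> ennreal" where
  "hausdorff_outer k S = (SUP \<delta>\<in>{0<..}. hausdorff_pre k \<delta> S)"

text \<open>
  By Caratheodory's criterion for metric outer measures, \<^const>\<open>hausdorff_outer\<close> is countably
  additive on the Borel sets, so \<^const>\<open>measure_of\<close> does not collapse to the zero measure here.
\<close>

definition hausdorff_measure :: "nat \<Rightarrow> 'a::metric_space measure" where
  "hausdorff_measure k = measure_of UNIV (sets borel) (hausdorff_outer k)"

definition surface_area :: "(real ^ 'n) set \<Rightarrow> ennreal" where
  "surface_area S = hausdorff_outer (CARD('n) - 1) S"

text \<open>
  Normalised surface measure, as a Borel measure on the whole space that is concentrated on the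
  unit sphere.
\<close>

definition sphere_measure :: "(real ^ 'n) measure" where
  "sphere_measure = uniform_measure (hausdorff_measure (CARD('n) - 1)) (sphere 0 1)"

definition poly_fun_deg_le :: "nat \<Rightarrow> (real ^ 'n \<Rightarrow> real) \<Rightarrow> bool" where
  "poly_fun_deg_le t p \<longleftrightarrow>
     (\<exists>a :: ('n \<Rightarrow> nat) \<Rightarrow> real.
        p = (\<lambda>u. \<Sum>\<alpha> | (\<Sum>i\<in>UNIV. \<alpha> i) \<le> t. a \<alpha> * (\<Prod>i\<in>UNIV. (u $ i) ^ \<alpha> i)))"

definition spherical_design :: "nat \<Rightarrow> (real ^ 'n) set \<Rightarrow> bool" where
  "spherical_design t X \<longleftrightarrow>
     finite X \<and> X \<noteq> {} \<and> X \<subseteq> sphere 0 1 \<and>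
     (\<forall>p. poly_fun_deg_le t p \<longrightarrow>
        (1 / real (card X)) * (\<Sum>x\<in>X. p x) = (LINT u|sphere_measure. p u))"

definition support_fun :: "'a::real_inner set \<Rightarrow> 'a \<Rightarrow> real" where
  "support_fun P u = (SUP y\<in>P. u \<bullet> y)"

definition support_face :: "'a::real_inner set \<Rightarrow> 'a \<Rightarrow> 'a set" where
  "support_face P u = {y\<in>P. u \<bullet> y = support_fun P u}"

definition polar :: "'a::real_inner set \<Rightarrow> 'a set" where
  "polar P = {z. \<forall>y\<in>P. z \<bullet> y \<le> 1}"

definition steiner_point :: "(real ^ 'n) set \<Rightarrow> real ^ 'n" where
  "steiner_point P = real CARD('n) *\<^sub>R (LINT u|sphere_measure. support_fun P u *\<^sub>R u)"

text \<open>
  The surface area measure of a convex body: the area of the set of boundary points that have an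
  outer unit normal in \<open>A\<close>. On a polytope only the facets contribute, so each facet puts an atom
  of weight its area at its outer unit normal.
\<close>

definition surface_area_measure :: "(real ^ 'n) set \<Rightarrow> (real ^ 'n) set \<Rightarrow> ennreal" where
  "surface_area_measure P A = surface_area (\<Union>u\<in>A \<inter> sphere 0 1. support_face P u)"

text \<open>
  The last two conjuncts spell out what the surface area measure equation means for a polytope:
  the facets are exactly the faces with outer unit normals in \<open>X\<close>, one for each element of \<open>X\<close>,
  and all have the same area. For given \<open>X\<close>, \<open>P\<close> is determined up to translation.
\<close>

definition minkowski_polytope :: "(real ^ 'n) set \<Rightarrow> (real ^ 'n) set \<Rightarrow> bool" where
  "minkowski_polytope X P \<longleftrightarrow>
     (let a = surface_area (sphere (0 :: real ^ 'n) 1) / of_nat (card X) in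
        polytope P \<and> interior P \<noteq> {} \<and> X \<subseteq> sphere 0 1 \<and>
        (\<forall>A\<in>sets borel. surface_area_measure P A = a * of_nat (card (X \<inter> A))) \<and>
        bij_betw (support_face P) X {F. F facet_of P} \<and>
        (\<forall>u\<in>X. surface_area (support_face P u) = a))"

definition orthogonally_congruent :: "(real ^ 'n) set \<Rightarrow> (real ^ 'n) set \<Rightarrow> bool" where
  "orthogonally_congruent X Y \<longleftrightarrow>
     (\<exists>V :: real ^ 'n ^ 'n. orthogonal_matrix V \<and> Y = (*v) V ` X)"

end

theory Submission
  imports Defs
begin

text \<open>
  Since the polar of \<open>P\<close> is bounded, \<open>0\<close> is interior to \<open>P\<close>, so \<open>P\<close> is cut out by its facet
  inequalities \<open>x\<^sub>i \<bullet> y \<le> h\<^sub>i\<close> with \<open>h\<^sub>i > 0\<close>, and the vertices of the polar are exactly the points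
  \<open>x\<^sub>i / h\<^sub>i\<close>. The self-polarity \<open>P\<degree> = c U P\<close> carries them to the vertices of \<open>P\<close>, and taking
  polars once more gives \<open>U\<^sup>2 P = P\<close>. Designs are preserved by \<open>U\<^sup>T\<close> because Hausdorff measure is
  invariant under isometries and polynomials of degree at most \<open>t\<close> are stable under linear
  substitutions.
\<close>

declare transpose_matrix_vector [simp del]

section \<open>Polar bodies and facets\<close>

lemma inner_le_support_fun:
  fixes P :: "'a::real_inner set"
  assumes "bounded P" "y \<in> P"
  shows "u \<bullet> y \<le> support_fun P u"
proof -
  have "bounded ((\<bullet>) u ` P)"
    using assms(1) bounded_linear_inner_right bounded_linear_image by blast
  then show ?thesis
    unfolding support_fun_def using assms(2) by (intro cSUP_upper bounded_imp_bdd_above)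
qed

text \<open>\<open>P\<close> contains a small ball about the origin, and the point of that ball in
  direction \<open>u\<close> already has positive inner product with \<open>u\<close>.\<close>

lemma support_fun_pos:
  fixes P :: "'a::real_inner set"
  assumes "bounded P" "0 \<in> interior P" "u \<noteq> 0"
  shows "0 < support_fun P u"
proof -
  obtain e where e: "e > 0" "cball 0 e \<subseteq> P"
    using assms(2) mem_interior_cball by blast
  have "(e / norm u) *\<^sub>R u \<in> P"
    using e assms(3) by (intro subsetD[OF e(2)]) auto
  then have "u \<bullet> ((e / norm u) *\<^sub>R u) \<le> support_fun P u"
    by (rule inner_le_support_fun[OF assms(1)])
  moreover have "u \<bullet> ((e / norm u) *\<^sub>R u) > 0"
    using e(1) assms(3) by simp
  ultimately show ?thesis by linarith
qed

text \<open>If \<open>P\<close> lies in the ball of radius \<open>B\<close>, then by Cauchy-Schwarz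
  its polar contains the ball of radius \<open>1 / B\<close>. This later rules out 0 as an extreme
  point of the polar.\<close>

lemma zero_in_interior_polar:
  fixes P :: "'a::euclidean_space set"
  assumes "bounded P"
  shows "0 \<in> interior (polar P)"
proof -
  obtain B where B: "B > 0" "\<And>y. y \<in> P \<Longrightarrow> norm y \<le> B"
    using assms bounded_pos by blast
  have "z \<bullet> y \<le> 1" if "z \<in> ball 0 (1 / B)" "y \<in> P" for z y
  proof -
    have "z \<bullet> y \<le> norm z * norm y" by (rule norm_cauchy_schwarz)
    also have "\<dots> \<le> (1 / B) * B"
      using that B by (intro mult_mono) auto
    finally show ?thesis using B(1) by simp
  qed
  then have "ball 0 (1 / B) \<subseteq> polar P" by (auto simp: polar_def)
  then show ?thesis using B(1) by (auto simp: mem_interior intro!: exI[of _ "1 / B"])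
qed

text \<open>Otherwise a hyperplane through 0 has \<open>P\<close> on one side. With \<open>a\<close>
  its normal pointing to that side, the whole ray of negative multiples of \<open>a\<close> lies in
  the polar, against boundedness.\<close>

lemma zero_in_interior_if_bounded_polar:
  fixes P :: "'a::euclidean_space set"
  assumes "convex P" "interior P \<noteq> {}" "bounded (polar P)"
  shows "0 \<in> interior P"
proof (rule ccontr)
  assume "0 \<notin> interior P"
  then obtain a where a: "a \<noteq> 0" "\<And>y. y \<in> interior P \<Longrightarrow> 0 \<le> a \<bullet> y"
    using separating_hyperplane_set_0[OF convex_interior[OF assms(1)]] by blast
  \<comment> \<open>A convex set with nonempty interior lies in the closure of that interior, so the
    sign condition extends to all of \<open>P\<close>.\<close>
  have "closure (interior P) \<subseteq> {y. a \<bullet> y \<ge> 0}"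
    using a(2) by (intro closure_minimal closed_halfspace_ge) auto
  then have nonneg: "a \<bullet> y \<ge> 0" if "y \<in> P" for y
    using that closure_subset convex_closure_interior[OF assms(1,2)] by blast
  obtain B where B: "\<And>z. z \<in> polar P \<Longrightarrow> norm z \<le> B"
    using assms(3) bounded_iff by blast
  \<comment> \<open>Chosen so that \<open>- s *\<^sub>R a\<close> has norm
    \<open>\<bar>B\<bar> + 1\<close>, which exceeds the bound \<open>B\<close>.\<close>
  define s where "s = (\<bar>B\<bar> + 1) / norm a"
  have "s \<ge> 0" by (simp add: s_def)
  have "- s *\<^sub>R a \<in> polar P"
    unfolding polar_def
    using mult_nonneg_nonneg[OF \<open>s \<ge> 0\<close> nonneg] by (auto intro: order.trans[of _ 0])
  then have "norm (- s *\<^sub>R a) \<le> B" by (rule B)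
  then show False using a(1) by (simp add: s_def)
qed

text \<open>Follow the ray from 0 through \<open>y\<close> until it leaves \<open>P\<close> at
  \<open>d *\<^sub>R y\<close>. Leaving before \<open>y\<close> would put the exit point on a facet
  whose inequality \<open>y\<close> then violates.\<close>

lemma polytope_mem_if_facet_inequalities:
  fixes P :: "'a::euclidean_space set"
  assumes "polytope P" "0 \<in> interior P"
    and facets: "\<And>F. F facet_of P \<Longrightarrow> F \<in> support_face P ` X"
    and X: "0 \<notin> X" "\<And>u. u \<in> X \<Longrightarrow> u \<bullet> y \<le> support_fun P u"
  shows "y \<in> P"
proof (cases "y = 0")
  case True
  then show ?thesis using assms(2) interior_subset by blast
next
  case False
  have bnd: "bounded P" and cl: "closed P"
    using assms(1) polytope_imp_bounded polytope_imp_closed by auto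
  obtain d where d: "d > 0" "0 + d *\<^sub>R y \<in> frontier P"
      "\<And>e. \<lbrakk>0 \<le> e; e < d\<rbrakk> \<Longrightarrow> 0 + e *\<^sub>R y \<in> interior P"
    using ray_to_frontier[OF bnd assms(2) False] by blast
  have fr: "d *\<^sub>R y \<in> P - interior P"
    using d(2) cl by (simp add: frontier_def)
  consider "d < 1" | "d = 1" | "d > 1" by linarith
  then show ?thesis
  proof cases
    case 1
    \<comment> \<open>The relative boundary of a polyhedron is the union of its facets; here
      relative and ordinary interior agree.\<close>
    have "rel_interior P = interior P"
      using assms(2) by (intro rel_interior_nonempty_interior) auto
    then have "d *\<^sub>R y \<in> \<Union>{F. F facet_of P}"
      using fr rel_boundary_of_polyhedron[OF polytope_imp_polyhedron[OF assms(1)]] by auto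
    then obtain u where u: "u \<in> X" "u \<bullet> (d *\<^sub>R y) = support_fun P u"
      using facets unfolding support_face_def by blast
    have pos: "0 < support_fun P u"
      using support_fun_pos[OF bnd assms(2)] X(1) u(1) by metis
    \<comment> \<open>The equation on the facet reads
      \<open>d * (u \<bullet> y) = support_fun P u\<close>, and \<open>u \<bullet> y\<close> is at
      most \<open>support_fun P u\<close>; a positive support value thus excludes
      \<open>d < 1\<close>.\<close>
    have "support_fun P u \<le> d * support_fun P u"
      using u(2) X(2)[OF u(1)] d(1) by (simp flip: u(2))
    then show ?thesis using 1 pos by simp
  next
    case 2
    then show ?thesis using fr by simp
  next
    case 3
    then show ?thesis using d(3)[of 1] interior_subset by auto
  qed
qed

text \<open>If \<open>z \<noteq> w\<close>, the affine hull of the facet is a hyperplane through \<open>0\<close>, where \<open>w \<bullet> y = 1\<close> fails.\<close>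

lemma eq_if_inner_eq_one_on_facet:
  fixes P :: "'a::euclidean_space set"
  assumes "interior P \<noteq> {}" "F facet_of P"
    and z: "\<And>y. y \<in> F \<Longrightarrow> z \<bullet> y = 1" and w: "\<And>y. y \<in> F \<Longrightarrow> w \<bullet> y = 1"
  shows "z = w"
proof (rule ccontr)
  assume "z \<noteq> w"
  have "aff_dim P = DIM('a)" using assms(1) by (rule aff_dim_nonempty_interior)
  then have dim: "aff_dim F = DIM('a) - 1"
    using assms(2) by (simp add: facet_of_def)
  have ne: "F \<noteq> {}" using assms(2) by (simp add: facet_of_def)
  have 1: "affine hull F \<subseteq> {y. (z - w) \<bullet> y = 0}"
    using z w by (intro hull_minimal affine_hyperplane) (auto simp: inner_diff_left)
  have 2: "affine hull F \<subseteq> {y. w \<bullet> y = 1}"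
    using w by (intro hull_minimal affine_hyperplane) auto
  have "affine hull F = {y. (z - w) \<bullet> y = 0}"
    using 1 ne dim \<open>z \<noteq> w\<close>
    by (intro affine_dim_equal) (auto simp: affine_hyperplane aff_dim_hyperplane)
  then have "0 \<in> affine hull F" by simp
  then show False using 2 by auto
qed

text \<open>The polar is the convex hull of 0 and the scaled normals, so its extreme points are
  among these. Conversely, a scaled normal is the only point of the polar whose inner product with
  every point of its facet is 1, so it cannot lie inside a segment of the polar.\<close>

lemma extreme_points_of_polar:
  fixes P :: "'a::euclidean_space set"
  assumes P: "polytope P" "0 \<in> interior P"
    and facets: "support_face P ` X = {F. F facet_of P}"
    and X: "finite X" "0 \<notin> X"
  shows "{v. v extreme_point_of polar P} = (\<lambda>u. (1 / support_fun P u) *\<^sub>R u) ` X"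
proof (intro equalityI subsetI)
  let ?f = "\<lambda>u. (1 / support_fun P u) *\<^sub>R u"
  have bnd: "bounded P" using P(1) by (rule polytope_imp_bounded)
  have pos: "0 < support_fun P u" if "u \<in> X" for u
    using support_fun_pos[OF bnd P(2)] X(2) that by metis
  {
    fix v assume v: "v \<in> {v. v extreme_point_of polar P}"
    \<comment> \<open>Including 0 makes the separation constant \<open>b\<close> below negative; at
      the end 0 is discarded because it is interior to the polar.\<close>
    define K where "K = convex hull (insert 0 (?f ` X))"
    have K: "compact K" "convex K"
      using X(1) by (auto simp: K_def finite_imp_compact_convex_hull)
    have K_polar: "K \<subseteq> polar P"
    proof -
      have "convex (polar P)"
        unfolding convex_def polar_def
        by (auto simp: inner_add_left intro!: convex_bound_le)
      moreover have "?f u \<in> polar P" if "u \<in> X" for u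
        using pos[OF that] inner_le_support_fun[OF bnd] by (auto simp: polar_def)
      ultimately show ?thesis
        unfolding K_def by (intro hull_minimal) (auto simp: polar_def)
    qed
    have polar_K: "polar P \<subseteq> K"
    proof (rule ccontr)
      assume "\<not> polar P \<subseteq> K"
      then obtain z where z: "z \<in> polar P" "z \<notin> K" by blast
      obtain a b where ab: "a \<bullet> z < b" "\<And>y. y \<in> K \<Longrightarrow> a \<bullet> y > b"
        using separating_hyperplane_closed_point[OF K(2) compact_imp_closed[OF K(1)] z(2)] by blast
      have "0 \<in> K" by (simp add: K_def hull_inc)
      then have b: "b < 0" using ab(2)[of 0] by simp
      \<comment> \<open>Dividing the separating functional by \<open>b < 0\<close> turns its bounds
        at the scaled normals into the facet inequalities, while \<open>a \<bullet> z < b\<close>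
        says that \<open>z\<close> exceeds 1 at the resulting point of \<open>P\<close>.\<close>
      have "(1 / b) *\<^sub>R a \<in> P"
      proof (rule polytope_mem_if_facet_inequalities[OF P _ X(2)])
        fix u assume u: "u \<in> X"
        then have "a \<bullet> ?f u > b" by (intro ab) (simp add: K_def hull_inc)
        then show "u \<bullet> ((1 / b) *\<^sub>R a) \<le> support_fun P u"
          using pos[OF u] b by (simp add: field_simps inner_commute)
      qed (use facets in blast)
      then have "z \<bullet> ((1 / b) *\<^sub>R a) \<le> 1" using z(1) unfolding polar_def by blast
      then show False using ab(1) b by (simp add: field_simps inner_commute)
    qed
    have "v extreme_point_of K" using v K_polar polar_K by auto
    then have "v = 0 \<or> v \<in> ?f ` X"
      unfolding K_def using extreme_point_of_convex_hull by blast
    moreover have "v \<noteq> 0"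
      using v extreme_point_not_in_interior[of v "polar P"] zero_in_interior_polar[OF bnd] by auto
    ultimately show "v \<in> ?f ` X" by blast
  next
    fix v assume "v \<in> ?f ` X"
    then obtain u where u: "u \<in> X" and v: "v = ?f u" by blast
    let ?F = "support_face P u"
    have F: "?F facet_of P" using u facets by blast
    have one: "v \<bullet> y = 1" if "y \<in> ?F" for y
      using that pos[OF u] by (simp add: v support_face_def)
    have "v \<in> polar P"
      using pos[OF u] inner_le_support_fun[OF bnd] by (auto simp: polar_def v)
    moreover have False
      if ab: "a \<in> polar P" "b \<in> polar P" "v \<in> open_segment a b" for a b
    proof -
      obtain s where s: "0 < s" "s < 1" "v = (1 - s) *\<^sub>R a + s *\<^sub>R b" and "a \<noteq> b"
        using ab(3) by (auto simp: in_segment)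
      have "a \<bullet> y = 1 \<and> b \<bullet> y = 1" if y: "y \<in> ?F" for y
      proof -
        have le: "a \<bullet> y \<le> 1" "b \<bullet> y \<le> 1"
          using ab(1,2) y by (auto simp: polar_def support_face_def)
        \<comment> \<open>Two nonnegative slacks have weighted sum 0 with positive weights, so both
          endpoints of the segment attain the value 1 on the facet.\<close>
        have eq: "(1 - s) * (1 - a \<bullet> y) + s * (1 - b \<bullet> y) = 0"
          using one[OF y] by (simp add: s(3) inner_add_left algebra_simps)
        have "(1 - s) * (1 - a \<bullet> y) \<ge> 0" "s * (1 - b \<bullet> y) \<ge> 0"
          using le s(1,2) by auto
        then have "(1 - s) * (1 - a \<bullet> y) = 0" "s * (1 - b \<bullet> y) = 0"
          using eq by linarith+
        then show ?thesis using s(1,2) by simp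
      qed
      then have "a = b"
        using P(2) F by (intro eq_if_inner_eq_one_on_facet[of P ?F]) auto
      then show False using \<open>a \<noteq> b\<close> by blast
    qed
    ultimately show "v \<in> {v. v extreme_point_of polar P}"
      unfolding extreme_point_of_def by blast
  }
qed

text \<open>Each scaled facet normal lies in the polar, so testing a point of the bipolar against
  these normals yields exactly the facet inequalities of \<open>P\<close>.\<close>

lemma polar_polar_polytope:
  fixes P :: "'a::euclidean_space set"
  assumes P: "polytope P" "0 \<in> interior P"
    and facets: "\<And>F. F facet_of P \<Longrightarrow> F \<in> support_face P ` X" and X: "0 \<notin> X"
  shows "polar (polar P) = P"
proof (intro equalityI subsetI)
  have bnd: "bounded P" using P(1) by (rule polytope_imp_bounded)
  fix y assume y: "y \<in> polar (polar P)"
  show "y \<in> P"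
  proof (rule polytope_mem_if_facet_inequalities[OF P facets X])
    fix u assume "u \<in> X"
    then have pos: "0 < support_fun P u"
      using support_fun_pos[OF bnd P(2)] X by metis
    have "(1 / support_fun P u) *\<^sub>R u \<in> polar P"
      using pos inner_le_support_fun[OF bnd] by (auto simp: polar_def)
    then have "y \<bullet> ((1 / support_fun P u) *\<^sub>R u) \<le> 1"
      using y unfolding polar_def[of "polar P"] by blast
    then show "u \<bullet> y \<le> support_fun P u" using pos by (simp add: field_simps inner_commute)
  qed
qed (auto simp: polar_def inner_commute)

text \<open>Extreme points are singleton faces, and an injective linear map preserves and reflects
  the face relation.\<close>

lemma extreme_points_of_linear_image:
  assumes "linear f" "inj f"
  shows "{v. v extreme_point_of f ` S} = f ` {v. v extreme_point_of S}"
proof (intro equalityI subsetI)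
  fix v assume v: "v \<in> {v. v extreme_point_of f ` S}"
  then obtain w where "v = f w" by (auto simp: extreme_point_of_def)
  then show "v \<in> f ` {v. v extreme_point_of S}"
    using v face_of_linear_image[OF assms, of "{w}" S] by (simp add: face_of_singleton)
next
  fix v assume "v \<in> f ` {v. v extreme_point_of S}"
  then show "v \<in> {v. v extreme_point_of f ` S}"
    using face_of_linear_image[OF assms, of "{_}" S] by (auto simp: face_of_singleton)
qed

lemma orthogonal_transformation_matrix_vector:
  fixes V :: "real ^ 'n ^ 'n"
  shows "orthogonal_matrix V \<Longrightarrow> orthogonal_transformation ((*v) V)"
  by (simp add: orthogonal_transformation_matrix)

section \<open>Rotation invariance of designs\<close>

text \<open>The images of the sets of a cover are a cover of the image by sets of the same
  diameters, hence of the same total weight.\<close>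

lemma hausdorff_pre_isometry_image_le:
  fixes f :: "'a::metric_space \<Rightarrow> 'a"
  assumes iso: "\<And>x y. dist (f x) (f y) = dist x y"
  shows "hausdorff_pre k \<delta> (f ` S) \<le> hausdorff_pre k \<delta> S"
  unfolding hausdorff_pre_def
proof (rule INF_mono)
  fix C :: "nat \<Rightarrow> 'a set"
  assume C: "C \<in> {C. S \<subseteq> (\<Union>i. C i) \<and> (\<forall>i. bounded (C i) \<and> diameter (C i) \<le> \<delta>)}"
  have diam: "diameter (f ` A) = diameter A" for A
  proof -
    have "(\<lambda>(x, y). dist x y) ` (f ` A \<times> f ` A) = (\<lambda>(x, y). dist x y) ` (A \<times> A)"
      by (force simp: iso image_iff)
    then show ?thesis by (simp add: diameter_def)
  qed
  have bnd: "bounded (f ` A)" if "bounded A" for A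
    using that by (auto simp: bounded_two_points iso)
  show "\<exists>D\<in>{C. f ` S \<subseteq> (\<Union>i. C i) \<and> (\<forall>i. bounded (C i) \<and> diameter (C i) \<le> \<delta>)}.
      (\<Sum>i. ennreal (unit_ball_vol (real k) * (diameter (D i) / 2) ^ k))
      \<le> (\<Sum>i. ennreal (unit_ball_vol (real k) * (diameter (C i) / 2) ^ k))"
    using C by (intro bexI[of _ "\<lambda>i. f ` C i"]) (auto simp: diam bnd simp flip: image_UN)
qed

lemma hausdorff_outer_isometry_image_le:
  fixes f :: "'a::metric_space \<Rightarrow> 'a"
  assumes "\<And>x y. dist (f x) (f y) = dist x y"
  shows "hausdorff_outer k (f ` S) \<le> hausdorff_outer k S"
  unfolding hausdorff_outer_def
  using hausdorff_pre_isometry_image_le[OF assms] by (intro SUP_mono) blast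

text \<open>The one-sided bound is applied to \<open>f\<close> and to its inverse, which is again an
  isometry. Preimages are the form that image measures call for.\<close>

lemma hausdorff_outer_isometry_vimage:
  fixes f :: "'a::metric_space \<Rightarrow> 'a"
  assumes "bij f" and iso: "\<And>x y. dist (f x) (f y) = dist x y"
  shows "hausdorff_outer k (f -` S) = hausdorff_outer k S"
proof (rule antisym)
  have "f -` S = inv f ` S" using assms(1) by (rule bij_vimage_eq_inv_image)
  moreover have "dist (inv f x) (inv f y) = dist x y" for x y
    using iso[of "inv f x" "inv f y"] assms(1) by (simp add: bij_is_surj surj_f_inv_f)
  ultimately show "hausdorff_outer k (f -` S) \<le> hausdorff_outer k S"
    by (simp add: hausdorff_outer_isometry_image_le)
  have "f ` (f -` S) = S" using assms(1) by (simp add: bij_is_surj surj_image_vimage_eq)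
  then show "hausdorff_outer k S \<le> hausdorff_outer k (f -` S)"
    using hausdorff_outer_isometry_image_le[OF iso] by metis
qed

lemma sets_hausdorff_measure [simp, measurable_cong]:
  "sets (hausdorff_measure k :: 'a::metric_space measure) = sets borel"
  by (simp add: hausdorff_measure_def sets.sigma_sets_eq[of borel, simplified])

lemma space_hausdorff_measure [simp]: "space (hausdorff_measure k) = UNIV"
  by (simp add: hausdorff_measure_def)

lemma emeasure_hausdorff_measure_isometry:
  fixes f :: "'a::metric_space \<Rightarrow> 'a"
  assumes "bij f" and iso: "\<And>x y. dist (f x) (f y) = dist x y" and "S \<in> sets borel"
  shows "emeasure (hausdorff_measure k) (f -` S) = emeasure (hausdorff_measure k) S"
proof -
  have "continuous_on UNIV f"
    unfolding continuous_on_iff using iso by auto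
  then have "f -` S \<in> sets borel"
    using measurable_sets[OF borel_measurable_continuous_onI assms(3)] by simp
  \<comment> \<open>\<open>emeasure_measure_of_conv\<close> yields the outer measure or the default
    value 0, by a condition that is the same for both Borel sets; in either case the two sides
    agree.\<close>
  then show ?thesis
    using assms(3) hausdorff_outer_isometry_vimage[OF assms(1,2)]
    by (simp add: hausdorff_measure_def emeasure_measure_of_conv
        sets.sigma_sets_eq[of borel, simplified])
qed

lemma sets_sphere_measure [simp, measurable_cong]: "sets sphere_measure = sets borel"
  by (simp add: sphere_measure_def)

lemma space_sphere_measure [simp]: "space sphere_measure = UNIV"
  by (simp add: sphere_measure_def)

text \<open>An orthogonal map preserves both the Hausdorff measure and the unit sphere, hence also
  the normalised restriction of the measure to the sphere.\<close>

lemma distr_sphere_measure_orthogonal: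
  fixes V :: "real ^ 'n ^ 'n"
  assumes "orthogonal_matrix V"
  shows "distr sphere_measure borel ((*v) V) = sphere_measure"
proof (rule measure_eqI)
  have orth: "orthogonal_transformation ((*v) V)"
    using assms by (rule orthogonal_transformation_matrix_vector)
  have bij: "bij ((*v) V)" using orth by (rule orthogonal_transformation_bij)
  have iso: "dist (V *v x) (V *v y) = dist x y" for x y
    using orth by (simp add: orthogonal_transformation_isometry)
  have nrm: "norm (V *v x) = norm x" for x
    using orth by (rule orthogonal_transformation_norm)
  have meas: "(*v) V \<in> borel_measurable borel"
    by (intro borel_measurable_continuous_onI linear_continuous_on matrix_vector_mul_bounded_linear)
  fix A assume "A \<in> sets (distr sphere_measure borel ((*v) V))"
  then have A: "A \<in> sets borel" by simp
  have vA: "(*v) V -` A \<in> sets borel" using measurable_sets[OF meas A] by simp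
  have "sphere 0 1 \<inter> (*v) V -` A = (*v) V -` (sphere 0 1 \<inter> A)"
    by (auto simp: nrm)
  then have "emeasure (hausdorff_measure k) (sphere 0 1 \<inter> (*v) V -` A)
      = emeasure (hausdorff_measure k) (sphere 0 1 \<inter> A)" for k
    using emeasure_hausdorff_measure_isometry[OF bij iso, of "sphere 0 1 \<inter> A"] A by simp
  then show "emeasure (distr sphere_measure borel ((*v) V)) A = emeasure sphere_measure A"
    using A vA meas
    by (simp add: emeasure_distr sphere_measure_def)
qed simp

section \<open>Polynomials of bounded degree\<close>

text \<open>Every entry of such a multiindex is at most \<open>t\<close>. Finiteness matters because
  a sum over an infinite index set is 0 by default.\<close>

lemma finite_multiindices: "finite {\<alpha> :: 'n::finite \<Rightarrow> nat. (\<Sum>i\<in>UNIV. \<alpha> i) \<le> t}"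
proof (rule finite_subset)
  show "{\<alpha> :: 'n \<Rightarrow> nat. (\<Sum>i\<in>UNIV. \<alpha> i) \<le> t} \<subseteq> (UNIV \<rightarrow>\<^sub>E {..t})"
  proof
    fix \<alpha> :: "'n \<Rightarrow> nat" assume "\<alpha> \<in> {\<alpha>. (\<Sum>i\<in>UNIV. \<alpha> i) \<le> t}"
    then have "\<alpha> i \<le> t" for i
      using member_le_sum[of i UNIV \<alpha>] by simp
    then show "\<alpha> \<in> UNIV \<rightarrow>\<^sub>E {..t}" by (simp add: PiE_UNIV_domain)
  qed
qed (simp add: finite_PiE)

lemma poly_fun_deg_le_monomial:
  assumes "(\<Sum>i\<in>UNIV. \<beta> i) \<le> t"
  shows "poly_fun_deg_le t (\<lambda>u :: real ^ 'n. b * (\<Prod>i\<in>UNIV. (u $ i) ^ \<beta> i))"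
proof -
  have "(\<Sum>\<alpha> | (\<Sum>i\<in>UNIV. \<alpha> i) \<le> t. (if \<alpha> = \<beta> then b else 0) * (\<Prod>i\<in>UNIV. (u $ i) ^ \<alpha> i))
      = (\<Sum>\<alpha> | (\<Sum>i\<in>UNIV. \<alpha> i) \<le> t. if \<alpha> = \<beta> then b * (\<Prod>i\<in>UNIV. (u $ i) ^ \<beta> i) else 0)"
    for u :: "real ^ 'n"
    by (rule sum.cong) auto
  then have "(\<Sum>\<alpha> | (\<Sum>i\<in>UNIV. \<alpha> i) \<le> t. (if \<alpha> = \<beta> then b else 0) * (\<Prod>i\<in>UNIV. (u $ i) ^ \<alpha> i))
      = b * (\<Prod>i\<in>UNIV. (u $ i) ^ \<beta> i)" for u :: "real ^ 'n"
    using assms by (simp only: sum.delta[OF finite_multiindices] mem_Collect_eq if_True)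
  then show ?thesis
    unfolding poly_fun_deg_le_def
    by (intro exI[of _ "\<lambda>\<alpha>. if \<alpha> = \<beta> then b else 0"] ext) (rule sym)
qed

lemma poly_fun_deg_le_sum:
  assumes "finite I" "\<And>i. i \<in> I \<Longrightarrow> poly_fun_deg_le t (p i)"
  shows "poly_fun_deg_le t (\<lambda>u. \<Sum>i\<in>I. p i u)"
proof -
  have "\<forall>i\<in>I. \<exists>a. p i =
      (\<lambda>u. \<Sum>\<alpha> | (\<Sum>j\<in>UNIV. \<alpha> j) \<le> t. a \<alpha> * (\<Prod>j\<in>UNIV. (u $ j) ^ \<alpha> j))"
    by (intro ballI assms(2)[unfolded poly_fun_deg_le_def])
  from bchoice[OF this] obtain a where a: "\<forall>i\<in>I. p i =
      (\<lambda>u. \<Sum>\<alpha> | (\<Sum>j\<in>UNIV. \<alpha> j) \<le> t. a i \<alpha> * (\<Prod>j\<in>UNIV. (u $ j) ^ \<alpha> j))" ..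
  have "(\<lambda>u. \<Sum>i\<in>I. p i u) =
      (\<lambda>u. \<Sum>\<alpha> | (\<Sum>j\<in>UNIV. \<alpha> j) \<le> t. (\<Sum>i\<in>I. a i \<alpha>) * (\<Prod>j\<in>UNIV. (u $ j) ^ \<alpha> j))"
    by (simp add: a sum_distrib_right) (subst sum.swap, rule refl)
  then show ?thesis unfolding poly_fun_deg_le_def by (intro exI)
qed

text \<open>The product expands into monomials with exponents \<open>\<alpha> j + \<beta> j\<close>.
  Different pairs may give the same exponent; closure under finite sums merges them without an
  explicit convolution of coefficients.\<close>

lemma poly_fun_deg_le_mult:
  fixes p q :: "real ^ 'n \<Rightarrow> real"
  assumes "poly_fun_deg_le s p" "poly_fun_deg_le t q"
  shows "poly_fun_deg_le (s + t) (\<lambda>u. p u * q u)"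
proof -
  obtain a b where p: "p = (\<lambda>u. \<Sum>\<alpha> | (\<Sum>j\<in>UNIV. \<alpha> j) \<le> s. a \<alpha> * (\<Prod>j\<in>UNIV. (u $ j) ^ \<alpha> j))"
    and q: "q = (\<lambda>u. \<Sum>\<beta> | (\<Sum>j\<in>UNIV. \<beta> j) \<le> t. b \<beta> * (\<Prod>j\<in>UNIV. (u $ j) ^ \<beta> j))"
    using assms unfolding poly_fun_deg_le_def by blast
  have "(\<lambda>u. p u * q u) = (\<lambda>u. \<Sum>\<alpha> | (\<Sum>j\<in>UNIV. \<alpha> j) \<le> s. \<Sum>\<beta> | (\<Sum>j\<in>UNIV. \<beta> j) \<le> t.
      (a \<alpha> * b \<beta>) * (\<Prod>j\<in>UNIV. (u $ j) ^ (\<alpha> j + \<beta> j)))"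
    unfolding p q sum_product by (simp add: power_add prod.distrib mult_ac)
  moreover have "poly_fun_deg_le (s + t) \<dots>"
    by (intro poly_fun_deg_le_sum finite_multiindices poly_fun_deg_le_monomial)
      (simp add: sum.distrib add_mono)
  ultimately show ?thesis by (simp only:)
qed

lemma poly_fun_deg_le_const: "poly_fun_deg_le t (\<lambda>u :: real ^ 'n. b)"
  using poly_fun_deg_le_monomial[of "\<lambda>_. 0" t b] by simp

lemma poly_fun_deg_le_linear: "poly_fun_deg_le 1 (\<lambda>u :: real ^ 'n. (V *v u) $ i)"
proof -
  have coord: "poly_fun_deg_le 1 (\<lambda>u :: real ^ 'n. b * u $ j)" for b j
  proof -
    \<comment> \<open>A coordinate is the monomial whose exponent is the indicator of
      \<open>j\<close>.\<close>
    have "(\<Prod>i\<in>UNIV. (u $ i) ^ (if i = j then 1 else 0)) = u $ j" for u :: "real ^ 'n"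
      by (simp add: if_distrib[of "\<lambda>n. _ ^ n"] cong: if_cong)
    then show ?thesis
      using poly_fun_deg_le_monomial[of "\<lambda>i. if i = j then 1 else 0" 1 b] by simp
  qed
  show ?thesis
    unfolding matrix_vector_mult_def vec_lambda_beta by (intro poly_fun_deg_le_sum coord finite)
qed

lemma poly_fun_deg_le_power:
  "poly_fun_deg_le s p \<Longrightarrow> poly_fun_deg_le (n * s) (\<lambda>u. p u ^ n)"
  by (induction n) (auto simp: poly_fun_deg_le_const dest: poly_fun_deg_le_mult)

lemma poly_fun_deg_le_prod:
  assumes "finite I" "\<And>i. i \<in> I \<Longrightarrow> poly_fun_deg_le (s i) (p i)"
  shows "poly_fun_deg_le (\<Sum>i\<in>I. s i) (\<lambda>u. \<Prod>i\<in>I. p i u)"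
  using assms
  by (induction I rule: finite_induct) (auto simp: poly_fun_deg_le_const intro: poly_fun_deg_le_mult)

text \<open>Multiply by the constant 1, regarded as a polynomial of degree at most
  \<open>t - s\<close>.\<close>

lemma poly_fun_deg_le_mono:
  assumes "poly_fun_deg_le s p" "s \<le> t"
  shows "poly_fun_deg_le t p"
  using poly_fun_deg_le_mult[OF assms(1) poly_fun_deg_le_const[of "t - s" 1]] assms(2) by simp

text \<open>The coordinates of \<open>V *v u\<close> are linear in \<open>u\<close>, so substitution
  turns a monomial into a product of powers of linear forms of the same total degree.\<close>

lemma poly_fun_deg_le_compose_linear:
  fixes V :: "real ^ 'n ^ 'n"
  assumes "poly_fun_deg_le t p"
  shows "poly_fun_deg_le t (\<lambda>u. p (V *v u))"
proof -
  obtain a where p: "p = (\<lambda>u. \<Sum>\<alpha> | (\<Sum>j\<in>UNIV. \<alpha> j) \<le> t. a \<alpha> * (\<Prod>j\<in>UNIV. (u $ j) ^ \<alpha> j))"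
    using assms unfolding poly_fun_deg_le_def by blast
  have "poly_fun_deg_le t (\<lambda>u :: real ^ 'n. a \<alpha> * (\<Prod>j\<in>UNIV. ((V *v u) $ j) ^ \<alpha> j))"
    if "(\<Sum>j\<in>UNIV. \<alpha> j) \<le> t" for \<alpha>
  proof -
    have "poly_fun_deg_le (\<Sum>j\<in>UNIV. \<alpha> j * 1) (\<lambda>u :: real ^ 'n. \<Prod>j\<in>UNIV. ((V *v u) $ j) ^ \<alpha> j)"
      by (intro poly_fun_deg_le_prod poly_fun_deg_le_power poly_fun_deg_le_linear) simp
    from poly_fun_deg_le_mult[OF poly_fun_deg_le_const[of 0] this]
    show ?thesis using that by (auto intro: poly_fun_deg_le_mono)
  qed
  then show ?thesis unfolding p by (intro poly_fun_deg_le_sum finite_multiindices) simp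
qed

lemma poly_fun_deg_le_borel_measurable:
  "poly_fun_deg_le t p \<Longrightarrow> p \<in> borel_measurable borel"
  unfolding poly_fun_deg_le_def
  by (auto intro!: borel_measurable_continuous_onI continuous_intros)

text \<open>Averaging \<open>p\<close> over the image is averaging \<open>p\<close> composed with
  \<open>V\<close> over \<open>X\<close>. The composite has degree at most \<open>t\<close>, and
  invariance of the sphere measure removes \<open>V\<close> from its integral.\<close>

lemma spherical_design_orthogonal_image:
  fixes V :: "real ^ 'n ^ 'n"
  assumes "orthogonal_matrix V" "spherical_design t X"
  shows "spherical_design t ((*v) V ` X)"
proof -
  have orth: "orthogonal_transformation ((*v) V)"
    using assms(1) by (rule orthogonal_transformation_matrix_vector)
  have inj: "inj_on ((*v) V) X"
    using orthogonal_transformation_inj[OF orth] by (rule inj_on_subset) simp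
  have meas: "(*v) V \<in> borel_measurable borel"
    by (intro borel_measurable_continuous_onI linear_continuous_on matrix_vector_mul_bounded_linear)
  have "(1 / real (card ((*v) V ` X))) * (\<Sum>x\<in>(*v) V ` X. p x) = (LINT u|sphere_measure. p u)"
    if p: "poly_fun_deg_le t p" for p
  proof -
    have "(1 / real (card X)) * (\<Sum>x\<in>X. p (V *v x)) = (LINT u|sphere_measure. p (V *v u))"
      using assms(2) poly_fun_deg_le_compose_linear[OF p] by (simp add: spherical_design_def)
    also have "\<dots> = (LINT u|distr sphere_measure borel ((*v) V). p u)"
      using meas poly_fun_deg_le_borel_measurable[OF p] by (subst integral_distr) simp_all
    also have "\<dots> = (LINT u|sphere_measure. p u)"
      by (simp only: distr_sphere_measure_orthogonal[OF assms(1)])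
    finally show ?thesis by (simp add: card_image[OF inj] sum.reindex[OF inj])
  qed
  then show ?thesis
    using assms(2) orthogonal_transformation_norm[OF orth] by (auto simp: spherical_design_def)
qed

section \<open>Polarity up to an orthogonal map\<close>

text \<open>Moving the map across the inner product shows that \<open>z\<close> is in the polar of
  the image iff \<open>c *\<^sub>R (transpose V *v z)\<close> is in \<open>polar P\<close>; for
  orthogonal \<open>V\<close> this condition is solved for \<open>z\<close> by \<open>V\<close> and
  \<open>1 / c\<close>.\<close>

lemma polar_scaled_orthogonal_image:
  fixes V :: "real ^ 'n ^ 'n"
  assumes "orthogonal_matrix V" "c \<noteq> 0"
  shows "polar ((\<lambda>y. c *\<^sub>R (V *v y)) ` P) = (\<lambda>y. (1 / c) *\<^sub>R (V *v y)) ` polar P"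
proof (intro equalityI subsetI)
  have tr: "z \<bullet> (V *v y) = (transpose V *v z) \<bullet> y" for z y
    by (simp add: transpose_matrix_vector dot_lmul_matrix)
  have inv: "V *v (transpose V *v z) = z" "transpose V *v (V *v z) = z" for z
    using assms(1) by (simp_all add: matrix_vector_mul_assoc orthogonal_matrix_def)
  {
    fix z assume z: "z \<in> polar ((\<lambda>y. c *\<^sub>R (V *v y)) ` P)"
    have "c *\<^sub>R (transpose V *v z) \<in> polar P"
      using z by (auto simp: polar_def tr)
    moreover have "z = (1 / c) *\<^sub>R (V *v (c *\<^sub>R (transpose V *v z)))"
      using assms(2) by (simp add: inv matrix_vector_mult_scaleR)
    ultimately show "z \<in> (\<lambda>y. (1 / c) *\<^sub>R (V *v y)) ` polar P" by blast
  next
    fix z assume "z \<in> (\<lambda>y. (1 / c) *\<^sub>R (V *v y)) ` polar P"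
    then show "z \<in> polar ((\<lambda>y. c *\<^sub>R (V *v y)) ` P)"
      using assms(2) by (auto simp: polar_def tr inv matrix_vector_mult_scaleR)
  }
qed

theorem theorem4p2:
  fixes t N :: nat
    and X P :: "(real ^ 'n) set"
    and x :: "nat \<Rightarrow> real ^ 'n"
    and c :: real
    and U :: "real ^ 'n ^ 'n"
    and h :: "nat \<Rightarrow> real"
  assumes "CARD('n) \<ge> 2" and "t \<ge> 2"
    and "bij_betw x {1..N} X"
    and "spherical_design t X"
    and "minkowski_polytope X P" and "steiner_point P = 0"
    and "c > 0" and "orthogonal_matrix U"
    and "polar P = (\<lambda>y. c *\<^sub>R (U *v y)) ` P"
    and "\<And>i. i \<in> {1..N} \<Longrightarrow> h i = support_fun P (x i)"
  shows "card {v. v extreme_point_of P} = N \<and>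
    (\<exists>y. bij_betw y {1..N} {v. v extreme_point_of P} \<and>
      (\<forall>j\<in>{1..N}.
         y j = (1 / (c * h j)) *\<^sub>R (transpose U *v x j) \<and>
         (1 / norm (y j)) *\<^sub>R y j = transpose U *v x j) \<and>
      (\<forall>i\<in>{1..N}. \<forall>j\<in>{1..N}.
         (U *v x i) \<bullet> x j \<le> c * h i * h j \<and>
         ((U *v x i) \<bullet> x j = c * h i * h j \<longleftrightarrow> y j \<in> support_face P (x i)))) \<and>
    spherical_design t ((\<lambda>v. (1 / norm v) *\<^sub>R v) ` {v. v extreme_point_of P}) \<and>
    orthogonally_congruent X ((\<lambda>v. (1 / norm v) *\<^sub>R v) ` {v. v extreme_point_of P}) \<and>
    (\<lambda>y. (U ** U) *v y) ` P = P"
proof -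
  have X_sub: "X \<subseteq> sphere 0 1" and P: "polytope P" "interior P \<noteq> {}"
    and facets: "support_face P ` X = {F. F facet_of P}"
    using assms(5) by (auto simp: minkowski_polytope_def Let_def bij_betw_def)
  have bnd: "bounded P" using P(1) by (rule polytope_imp_bounded)
  have fin: "finite X" using assms(4) by (simp add: spherical_design_def)
  have X0: "0 \<notin> X" using X_sub by auto
  have orthT: "orthogonal_matrix (transpose U)"
    using assms(8) by (simp add: orthogonal_matrix_transpose)
  have ot: "orthogonal_transformation ((*v) (transpose U))"
    using orthT by (rule orthogonal_transformation_matrix_vector)
  note nrm = orthogonal_transformation_norm[OF ot]
  have inv: "transpose U *v (U *v z) = z" for z
    using assms(8) by (simp add: matrix_vector_mul_assoc orthogonal_matrix_def)
  have tr: "x i \<bullet> (transpose U *v x j) = (U *v x i) \<bullet> x j" for i j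
    by (metis dot_lmul_matrix transpose_matrix_vector transpose_transpose)

  \<comment> \<open>The polar is a linear image of the bounded set \<open>P\<close>; its boundedness
    places 0 in the interior of \<open>P\<close>.\<close>
  have "bounded (polar P)"
    unfolding assms(9)
    by (intro bounded_scaling[of "(*v) U ` P" c, unfolded image_image]
        bounded_linear_image[OF bnd] matrix_vector_mul_bounded_linear)
  then have int: "0 \<in> interior P"
    using zero_in_interior_if_bounded_polar P polytope_imp_convex by blast

  let ?g = "\<lambda>z. (1 / c) *\<^sub>R (transpose U *v z)"
  let ?E = "{v. v extreme_point_of P}"
  \<comment> \<open>\<open>?g\<close> inverts \<open>y \<mapsto> c *\<^sub>R (U *v y)\<close>, so it
    carries the polar, together with its extreme points, back to \<open>P\<close>.\<close>
  have "?g ` polar P = P"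
    unfolding assms(9) image_image using assms(7)
    by (simp add: matrix_vector_mult_scaleR inv)
  moreover have "linear ?g"
    by (intro linear_compose_scale_right matrix_vector_mul_linear)
  moreover have "inj ?g"
    using orthogonal_transformation_inj[OF ot] assms(7) by (auto simp: inj_def)
  ultimately have "?E = ?g ` {v. v extreme_point_of polar P}"
    using extreme_points_of_linear_image[of ?g "polar P"] by simp
  then have E: "?E = (\<lambda>u. (1 / (c * support_fun P u)) *\<^sub>R (transpose U *v u)) ` X"
    by (simp add: extreme_points_of_polar[OF P(1) int facets fin X0] image_image
        matrix_vector_mult_scaleR)

  define y where "y j = (1 / (c * h j)) *\<^sub>R (transpose U *v x j)" for j
  have xX: "x j \<in> X" if "j \<in> {1..N}" for j
    using assms(3) that by (auto simp: bij_betw_def)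
  have x1: "norm (x j) = 1" if "j \<in> {1..N}" for j
    using X_sub xX[OF that] by auto
  have hpos: "h j > 0" if "j \<in> {1..N}" for j
    using support_fun_pos[OF bnd int, of "x j"] xX[OF that] X0 assms(10)[OF that] by metis
  \<comment> \<open>\<open>y j\<close> is a positive multiple of the unit vector
    \<open>transpose U *v x j\<close>, so normalising removes the factor.\<close>
  have unit: "(1 / norm (y j)) *\<^sub>R y j = transpose U *v x j" if "j \<in> {1..N}" for j
    using hpos[OF that] assms(7) x1[OF that] by (simp add: y_def nrm)
  have yE: "y ` {1..N} = ?E"
  proof -
    have "X = x ` {1..N}" using assms(3) by (simp add: bij_betw_def)
    then show ?thesis
      unfolding E by (auto simp: y_def image_image assms(10) intro!: image_cong)
  qed
  \<comment> \<open>The direction of \<open>y j\<close> already determines \<open>x j\<close>, hence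
    the label \<open>j\<close>.\<close>
  have "inj_on y {1..N}"
  proof (rule inj_onI)
    fix i j assume ij: "i \<in> {1..N}" "j \<in> {1..N}" "y i = y j"
    then have "transpose U *v x i = transpose U *v x j" using unit by metis
    then have "x i = x j" using orthogonal_transformation_inj[OF ot] by (auto dest: injD)
    then show "i = j" using assms(3) ij(1,2) by (auto simp: bij_betw_def dest: inj_onD)
  qed
  then have bij: "bij_betw y {1..N} ?E" using yE by (simp add: bij_betw_def)
  then have card: "card ?E = N" using bij_betw_same_card by fastforce

  have ineq: "(U *v x i) \<bullet> x j \<le> c * h i * h j \<and>
      ((U *v x i) \<bullet> x j = c * h i * h j \<longleftrightarrow> y j \<in> support_face P (x i))"
    if ij: "i \<in> {1..N}" "j \<in> {1..N}" for i j
  proof -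
    have yP: "y j \<in> P" using yE ij(2) by (auto simp: extreme_point_of_def)
    have pos: "c * h j > 0" using hpos[OF ij(2)] assms(7) by simp
    \<comment> \<open>The claim is the support inequality \<open>x i \<bullet> y j \<le> h i\<close>
      multiplied by the positive number \<open>c * h j\<close>; equality is membership in the face
      with normal \<open>x i\<close>.\<close>
    have "(U *v x i) \<bullet> x j = (c * h j) * (x i \<bullet> y j)"
      using hpos[OF ij(2)] assms(7) by (simp add: y_def tr)
    moreover have "c * h i * h j = (c * h j) * h i" by simp
    moreover have "x i \<bullet> y j \<le> h i"
      using inner_le_support_fun[OF bnd yP] assms(10)[OF ij(1)] by simp
    moreover have "y j \<in> support_face P (x i) \<longleftrightarrow> x i \<bullet> y j = h i"
      using yP assms(10)[OF ij(1)] by (simp add: support_face_def)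
    ultimately show ?thesis using pos by (simp only: mult_le_cancel_left_pos) auto
  qed

  have dirs: "(\<lambda>v. (1 / norm v) *\<^sub>R v) ` ?E = (*v) (transpose U) ` X"
  proof -
    have "(\<lambda>v. (1 / norm v) *\<^sub>R v) ` ?E = (\<lambda>j. transpose U *v x j) ` {1..N}"
      unfolding yE[symmetric] image_image using unit by (intro image_cong) auto
    also have "\<dots> = (*v) (transpose U) ` X"
      using assms(3) by (auto simp: bij_betw_def image_image)
    finally show ?thesis .
  qed

  \<comment> \<open>Self-polarity is used twice: the polar of \<open>c U P\<close> is
    \<open>(1 / c) U\<close> applied to \<open>polar P\<close>, and replacing \<open>polar P\<close>
    by \<open>c U P\<close> again cancels the scalars and leaves \<open>U ** U\<close>.\<close>
  have "P = polar (polar P)"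
    using polar_polar_polytope[OF P(1) int _ X0] facets by blast
  also have "\<dots> = (\<lambda>y. (1 / c) *\<^sub>R (U *v y)) ` polar P"
    using polar_scaled_orthogonal_image[OF assms(8), of c P] assms(7,9) by simp
  also have "\<dots> = (\<lambda>y. (U ** U) *v y) ` P"
    unfolding assms(9) image_image using assms(7)
    by (simp add: matrix_vector_mult_scaleR matrix_vector_mul_assoc)
  finally have square: "(\<lambda>y. (U ** U) *v y) ` P = P" ..

  have "spherical_design t ((*v) (transpose U) ` X)"
    using orthT assms(4) by (rule spherical_design_orthogonal_image)
  moreover have "orthogonally_congruent X ((*v) (transpose U) ` X)"
    using orthT unfolding orthogonally_congruent_def by blast
  moreover have "\<forall>j\<in>{1..N}. y j = (1 / (c * h j)) *\<^sub>R (transpose U *v x j) \<and>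
      (1 / norm (y j)) *\<^sub>R y j = transpose U *v x j"
    using unit by (simp add: y_def)
  ultimately show ?thesis
    unfolding dirs using card bij ineq square by blast
qed

end
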